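(* Let $\mathfrak{g}$ be a finite-dimensional Lie algebra over a field $K$ of arbitrary characteristic $p\ge 0$. Suppose that $\mathfrak{g}$ admits a periodic derivation $D$ of order $n$ such that $p$ does not divide $\rho_n$. Then $\mathfrak{g}$ is nilpotent of class \[ c(\mathfrak{g})\le \begin{cases} 1 & \text{ if } n\not\equiv 0\bmod 6,\\ 2 & \text{ if } n\equiv 0\bmod 6.\end{cases} \]
   Context: A derivation $D$ of a Lie algebra is called periodic of order $n$ (with $n\ge 1$) if $D^n=\mathrm{id}$ and $D^k\neq \mathrm{id}$ for all $0<k<n$. $c(\mathfrak{g})$ denotes the nilpotency class. $R(f,g)$ denotes the resultant of two polynomials $f,g$ (the determinant of their Sylvester matrix), and $\Phi_3=t^2+t+1\in\mathbb{Z}[t]$ is the third cyclotomic polynomial. For $n\ge 1$ the nonzero integer $\rho_n$ is defined by \[ \rho_n=\begin{cases} R(t^n-1,(t+1)^n-1) & \text{ if } n\not\equiv 0 \bmod 6,\\ R\left(\frac{t^n-1}{\Phi_3},\frac{(t+1)^n-1}{\Phi_3}\right) & \text{ if } n\equiv 0\bmod 6.\end{cases} \] For $p=0$, "$p$ divides $\rho_n$" means $\rho_n=0$, so the condition $p\nmid\rho_n$ always holds. *)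

theory Defs
  imports "Subresultants.Resultant_Prelim"
begin

text \<open>The underlying set of a Lie algebra is the whole type \<open>'a\<close>; the base field is a type of class
  \<^class>\<open>field\<close>, of any characteristic.\<close>

locale lie_algebra = vector_space scale
  for scale :: "'k::field \<Rightarrow> 'a::ab_group_add \<Rightarrow> 'a" +
  fixes bracket :: "'a \<Rightarrow> 'a \<Rightarrow> 'a"
  assumes linear_left: "Vector_Spaces.linear scale scale (\<lambda>x. bracket x y)"
    and linear_right: "Vector_Spaces.linear scale scale (\<lambda>y. bracket x y)"
    and alternating: "bracket x x = 0"
    and jacobi: "bracket x (bracket y z) + bracket y (bracket z x) + bracket z (bracket x y) = 0"
begin

text \<open>The index is shifted by one: \<open>lower_central c\<close> is the term usually written
  \<open>\<gamma>\<^sub>c\<^sub>+\<^sub>1(g)\<close>, so that the class is the least \<open>c\<close> with \<open>lower_central c = {0}\<close>.\<close>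

primrec lower_central :: "nat \<Rightarrow> 'a set" where
  "lower_central 0 = UNIV"
| "lower_central (Suc i) = span {bracket x y |x y. y \<in> lower_central i}"

definition nilpotent :: bool where
  "nilpotent \<longleftrightarrow> (\<exists>c. lower_central c = {0})"

text \<open>Meaningful only when the algebra is nilpotent.\<close>

definition nilpotency_class :: nat where
  "nilpotency_class = (LEAST c. lower_central c = {0})"

definition derivation :: "('a \<Rightarrow> 'a) \<Rightarrow> bool" where
  "derivation D \<longleftrightarrow> Vector_Spaces.linear scale scale D \<and>
     (\<forall>x y. D (bracket x y) = bracket (D x) y + bracket x (D y))"

definition periodic_derivation :: "('a \<Rightarrow> 'a) \<Rightarrow> nat \<Rightarrow> bool" where
  "periodic_derivation D n \<longleftrightarrow> derivation D \<and> n \<ge> 1 \<and> D ^^ n = id \<and>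
     (\<forall>k. 0 < k \<and> k < n \<longrightarrow> D ^^ k \<noteq> id)"

end

definition Phi3 :: "int poly" where
  "Phi3 = [:1, 1, 1:]"

text \<open>The two polynomials are \<open>t\<^sup>n - 1\<close> and \<open>(t + 1)\<^sup>n - 1\<close>. Division of integer polynomials is only
  meaningful when exact; see \<open>Phi3_dvd_power_minus_one\<close> and \<open>Phi3_dvd_shifted_power_minus_one\<close>.\<close>

definition rho :: "nat \<Rightarrow> int" where
  "rho n = (if n mod 6 \<noteq> 0
     then resultant ([:0, 1:] ^ n - 1) ([:1, 1:] ^ n - 1)
     else resultant (([:0, 1:] ^ n - 1) div Phi3) (([:1, 1:] ^ n - 1) div Phi3))"

lemma power_minus_one_dvd:
  fixes a :: "'b::comm_ring_1"
  assumes "d dvd n"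
  shows "a ^ d - 1 dvd a ^ n - 1"
proof -
  obtain k where "n = d * k" using assms by blast
  then have "a ^ n - 1 = (a ^ d - 1) * (\<Sum>i<k. (a ^ d) ^ i)"
    using power_diff_1_eq[of "a ^ d" k] by (simp add: power_mult)
  then show ?thesis by simp
qed

lemma Phi3_dvd_power_minus_one:
  assumes "n mod 6 = 0"
  shows "Phi3 dvd [:0, 1:] ^ n - 1"
proof -
  have "([:0, 1:] :: int poly) ^ 6 - 1 = Phi3 * [:-1, 1, 0, -1, 1:]"
    by (simp add: Phi3_def eval_nat_numeral one_pCons)
  then have "Phi3 dvd [:0, 1:] ^ 6 - 1" by (rule dvdI)
  also have "[:0, 1:] ^ 6 - 1 dvd ([:0, 1:] :: int poly) ^ n - 1"
    using assms by (intro power_minus_one_dvd) auto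
  finally show ?thesis .
qed

lemma Phi3_dvd_shifted_power_minus_one:
  assumes "n mod 6 = 0"
  shows "Phi3 dvd [:1, 1:] ^ n - 1"
proof -
  have "([:1, 1:] :: int poly) ^ 6 - 1 = Phi3 * [:0, 6, 9, 5, 1:]"
    by (simp add: Phi3_def eval_nat_numeral one_pCons)
  then have "Phi3 dvd [:1, 1:] ^ 6 - 1" by (rule dvdI)
  also have "[:1, 1:] ^ 6 - 1 dvd ([:1, 1:] :: int poly) ^ n - 1"
    using assms by (intro power_minus_one_dvd) auto
  finally show ?thesis .
qed

end

theory Submission
  imports Defs
begin

text \<open>The operator \<open>T = D\<^sup>-\<^sup>1 \<otimes> D\<close> acts on bilinear maps, and the identities \<open>D\<^sup>n = 1\<close> on the arguments
  and on the values of the bracket say that \<open>T\<^sup>n - 1\<close> and \<open>(T + 1)\<^sup>n - 1\<close> both kill the bracket.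
  Since the resultant of two integer polynomials lies in the ideal they generate, \<open>\<rho>\<^sub>n\<close> times the bracket
  is zero when \<open>6\<close> does not divide \<open>n\<close>, and \<open>\<rho>\<^sub>n \<Phi>\<^sub>3(T)\<close> kills the bracket otherwise. In the latter
  case \<open>E = D\<^sup>3\<close> satisfies \<open>E [x, y] = - [E x, y] = - [x, E y]\<close>, and feeding this into the Jacobi
  identity gives \<open>2 [E z, [x, y]] = 0\<close>. Characteristic 2 is excluded because there \<open>\<Phi>\<^sub>3\<close> divides both
  quotients defining \<open>\<rho>\<^sub>n\<close>. This eigenvalue-free argument needs no extension of scalars.\<close>

section \<open>The resultant as a combination of its arguments\<close>

text \<open>Cramer's rule without division: the rows of the Sylvester matrix are coefficient vectors
  of shifts of \<open>p\<close> and \<open>q\<close>, and the last row of the adjugate combines them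
  into the determinant times the last unit vector. The degree condition guarantees a last
  row.\<close>

lemma resultant_in_ideal:
  fixes p q :: "'b::comm_ring_1 poly"
  assumes deg: "degree p + degree q > 0"
  shows "\<exists>u v. u * p + v * q = [:resultant p q:]"
proof -
  define m n where "m = degree p" and "n = degree q"
  define S where "S = sylvester_mat p q"
  have S: "S \<in> carrier_mat (m + n) (m + n)"
    unfolding S_def m_def n_def by (rule sylvester_carrier_mat)
  note adj = adj_mat[OF S]
  define b where "b i = adj_mat S $$ (m + n - 1, i)" for i
  have row: "(\<Sum>i<m+n. b i * S $$ (i, j)) = (if j = m + n - 1 then resultant p q else 0)"
    if j: "j < m + n" for j
  proof -
    have "(\<Sum>i<m+n. b i * S $$ (i, j)) = (adj_mat S * S) $$ (m + n - 1, j)"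
      using j S adj(1)
      by (simp add: times_mat_def scalar_prod_def b_def lessThan_atLeast0)
    also have "\<dots> = (det S \<cdot>\<^sub>m 1\<^sub>m (m + n)) $$ (m + n - 1, j)"
      by (simp only: adj(3))
    finally show ?thesis
      using j by (auto simp: resultant_def S_def)
  qed
  define u where "u = (\<Sum>i<n. smult (b i) (monom 1 (n - 1 - i)))"
  define v where "v = (\<Sum>i<m. smult (b (n + i)) (monom 1 (m - 1 - i)))"
  have "coeff (u * p + v * q) k = coeff [:resultant p q:] k" for k
  proof -
    have expand: "coeff (u * p + v * q) k =
      (\<Sum>i<n. b i * coeff (monom 1 (n - 1 - i) * p) k) +
      (\<Sum>i<m. b (n + i) * coeff (monom 1 (m - 1 - i) * q) k)"
      by (simp add: u_def v_def sum_distrib_right coeff_sum)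
    show ?thesis
    proof (cases "k < m + n")
      case True
      \<comment> \<open>Columns run through descending degrees, so the last column holds the
        constant terms.\<close>
      define j where "j = m + n - 1 - k"
      have j: "j < m + n" "m + n - j = Suc k"
        using True by (auto simp: j_def)
      have S1: "coeff (monom 1 (n - 1 - i) * p) k = S $$ (i, j)" if "i < n" for i
      proof -
        have "n - i = Suc (n - 1 - i)" using that by simp
        then show ?thesis
          using that j sylvester_index_mat2[of i p q j]
          by (simp add: S_def m_def n_def coeff_monom_mult)
      qed
      have S2: "coeff (monom 1 (m - 1 - i) * q) k = S $$ (n + i, j)" if "i < m" for i
      proof -
        have "m + n - (n + i) = Suc (m - 1 - i)" using that by simp
        then show ?thesis
          using that j sylvester_index_mat2[of "n + i" p q j]
          by (simp add: S_def m_def n_def coeff_monom_mult)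
      qed
      have split: "(\<Sum>i<n+l. h i) = (\<Sum>i<n. h i) + (\<Sum>i<l. h (n + i))" for l and h :: "nat \<Rightarrow> 'b"
        by (induction l) (simp_all add: add.assoc)
      have "coeff (u * p + v * q) k = (\<Sum>i<n. b i * S $$ (i, j)) + (\<Sum>i<m. b (n + i) * S $$ (n + i, j))"
        unfolding expand using S1 S2 by (intro arg_cong2[of _ _ _ _ "(+)"] sum.cong) auto
      also have "\<dots> = (\<Sum>i<n+m. b i * S $$ (i, j))"
        by (rule split[symmetric])
      also have "\<dots> = (if j = m + n - 1 then resultant p q else 0)"
        using row[OF j(1)] by (simp add: add.commute)
      also have "\<dots> = coeff [:resultant p q:] k"
        using True by (auto simp: j_def coeff_pCons split: nat.split)
      finally show ?thesis .
    next
      case False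
      have "coeff (monom 1 (n - 1 - i) * p) k = 0" if "i < n" for i
        using that False by (auto simp: coeff_monom_mult m_def intro!: coeff_eq_0)
      moreover have "coeff (monom 1 (m - 1 - i) * q) k = 0" if "i < m" for i
        using that False by (auto simp: coeff_monom_mult n_def intro!: coeff_eq_0)
      moreover have "k \<noteq> 0" using False deg unfolding m_def n_def by linarith
      ultimately show ?thesis
        unfolding expand by (simp add: coeff_pCons split: nat.split)
    qed
  qed
  then have "u * p + v * q = [:resultant p q:]" by (intro poly_eqI)
  then show ?thesis by blast
qed

section \<open>\<open>rho n\<close> as an integer polynomial combination\<close>

lemma degree_power_minus_one:
  assumes "n > 0"
  shows "degree ([:0, 1:] ^ n - 1 :: 'b::idom poly) = n"
proof -
  have "degree ([:0, 1:] ^ n - 1 :: 'b poly) = degree ([:0, 1:] ^ n :: 'b poly)"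
    using assms degree_add_eq_left[of "- 1" "[:0, 1:] ^ n :: 'b poly"] by (simp add: degree_power_eq)
  then show ?thesis by (simp add: degree_power_eq)
qed

lemma rho_in_ideal:
  assumes "n > 0" "n mod 6 \<noteq> 0"
  shows "\<exists>u v. u * ([:0, 1:] ^ n - 1) + v * ([:1, 1:] ^ n - 1) = [:rho n:]"
  using resultant_in_ideal[of "[:0, 1:] ^ n - 1 :: int poly" "[:1, 1:] ^ n - 1"] assms
  by (simp add: rho_def degree_power_minus_one)

lemma rho_in_ideal_quotients:
  assumes "n > 0" "n mod 6 = 0"
  obtains f g u v :: "int poly"
  where "[:0, 1:] ^ n - 1 = Phi3 * f" "[:1, 1:] ^ n - 1 = Phi3 * g" "u * f + v * g = [:rho n:]"
proof -
  obtain f g where f: "[:0, 1:] ^ n - 1 = Phi3 * f" and g: "[:1, 1:] ^ n - 1 = Phi3 * g"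
    using Phi3_dvd_power_minus_one Phi3_dvd_shifted_power_minus_one assms(2) by (meson dvdE)
  have Phi3: "Phi3 \<noteq> 0" "degree Phi3 = 2" by (simp_all add: Phi3_def)
  have "f \<noteq> 0"
    using f degree_power_minus_one[OF assms(1), where 'b = int] assms(1) by auto
  then have "n = 2 + degree f"
    using f degree_power_minus_one[OF assms(1), where 'b = int] Phi3 by (simp add: degree_mult_eq)
  \<comment> \<open>As 6 divides \<open>n\<close>, \<open>n = 2\<close> is impossible; a positive
    degree makes the resultant lemma applicable.\<close>
  then have "degree f > 0" using assms by (cases "n = 2") auto
  then obtain u v where "u * f + v * g = [:resultant f g:]"
    using resultant_in_ideal[of f g] by auto
  moreover have "rho n = resultant f g"
    using assms(2) Phi3 by (simp add: rho_def f g)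
  ultimately show thesis using that f g by metis
qed

text \<open>With \<open>n = m * 2\<close>, both power polynomials become squares
  \<open>(a ^ m - 1) ^ 2\<close> in characteristic 2, and \<open>3 dvd m\<close> makes
  \<open>\<Phi>\<close> divide each base. Cancelling one \<open>\<Phi>\<close> leaves another in
  each quotient, hence in the constant \<open>rho n\<close>.\<close>

lemma CHAR_2_imp_rho_eq_0:
  assumes "n > 0" "n mod 6 = 0" and char: "(2 :: 'k::field) = 0"
  shows "(of_int (rho n) :: 'k) = 0"
proof -
  define \<Phi> :: "'k poly" where "\<Phi> = [:1, 1, 1:]"
  obtain f g u v :: "int poly" where
    f: "[:0, 1:] ^ n - 1 = Phi3 * f" and g: "[:1, 1:] ^ n - 1 = Phi3 * g" and
    uv: "u * f + v * g = [:rho n:]"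
    using rho_in_ideal_quotients[OF assms(1,2)] by metis
  let ?h = "of_int_poly :: int poly \<Rightarrow> 'k poly"
  have Phi: "?h Phi3 = \<Phi>" by (simp add: Phi3_def \<Phi>_def)
  have \<Phi>0: "\<Phi> \<noteq> 0" by (simp add: \<Phi>_def)
  obtain m where n: "n = m * 2" and m: "3 dvd m"
  proof
    show "n = (n div 2) * 2" "3 dvd n div 2" using assms(2) by presburger+
  qed
  have two: "(2 :: 'k poly) = 0"
    using char by (metis of_nat_poly of_nat_numeral pCons_0_0)
  have quotient: "\<Phi> dvd ?h r" if r: "[:c, 1:] ^ n - 1 = Phi3 * r" and c: "\<Phi> dvd [:of_int c, 1:] ^ 3 - 1"
    for r :: "int poly" and c :: int
  proof -
    let ?a = "[:of_int c, 1:] :: 'k poly"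
    obtain s where s: "?a ^ m - 1 = \<Phi> * s"
      using dvd_trans[OF c power_minus_one_dvd[OF m, of ?a]] by (rule dvdE)
    have "\<Phi> * ?h r = ?h ([:c, 1:] ^ n - 1)"
      by (simp add: r hom_distribs Phi)
    also have "\<dots> = ?a ^ n - 1"
      by (simp add: hom_distribs)
    also have "\<dots> = (?a ^ m - 1) ^ 2 + 2 * (?a ^ m - 1)"
      by (simp add: n power_mult power2_eq_square algebra_simps)
    also have "\<dots> = \<Phi> * (\<Phi> * s ^ 2)"
      by (simp add: two s power2_eq_square algebra_simps)
    finally show ?thesis using \<Phi>0 by simp
  qed
  have "([:0, 1:] :: 'k poly) ^ 3 - 1 = \<Phi> * [:-1, 1:]"
    by (simp add: \<Phi>_def eval_nat_numeral one_pCons)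
  then have "\<Phi> dvd [:of_int 0, 1:] ^ 3 - 1" by (metis dvd_triv_left of_int_0)
  then have "\<Phi> dvd ?h f" by (rule quotient[OF f])
  moreover have "([:1, 1:] :: 'k poly) ^ 3 - 1 = \<Phi> * [:0, 1:]"
  proof -
    have "([:1, 1:] :: 'k poly) ^ 3 - 1 = \<Phi> * [:0, 1:] + 2 * [:0, 1, 1:]"
      by (simp add: \<Phi>_def eval_nat_numeral one_pCons numeral_poly)
    then show ?thesis by (simp add: two)
  qed
  then have "\<Phi> dvd [:of_int 1, 1:] ^ 3 - 1" by (metis dvd_triv_left of_int_1)
  then have "\<Phi> dvd ?h g" by (rule quotient[OF g])
  ultimately have "\<Phi> dvd ?h (u * f + v * g)" by (simp add: hom_distribs)
  then have "\<Phi> dvd [:of_int (rho n):]" by (simp add: uv hom_distribs)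
  \<comment> \<open>A polynomial of degree 2 divides no nonzero constant.\<close>
  then show ?thesis
    by (rule contrapos_pp) (auto simp: \<Phi>_def dest!: dvd_imp_degree_le)
qed

section \<open>Polynomials in the operator \<open>D\<^sup>-\<^sup>1 \<otimes> D\<close>\<close>

locale invertible_derivation = lie_algebra scale bracket
  for scale :: "'k::field \<Rightarrow> 'a::ab_group_add \<Rightarrow> 'a" and bracket +
  fixes D P :: "'a \<Rightarrow> 'a"
  assumes derivation: "derivation D"
    and D_P: "D (P x) = x"
    and P_D: "P (D x) = x"
begin

lemma bracket_add_right: "bracket x (y + z) = bracket x y + bracket x z"
  using linear_right[of x] unfolding Vector_Spaces.linear_iff by blast

lemma bracket_minus_right: "bracket x (- y) = - bracket x y"
proof -
  have "bracket x 0 = 0" using bracket_add_right[of x 0 0] by simp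
  then show ?thesis
    using bracket_add_right[of x y "- y"] by (simp add: eq_neg_iff_add_eq_0 add.commute)
qed

lemma D_bracket: "D (bracket x y) = bracket (D x) y + bracket x (D y)"
  using derivation by (simp add: derivation_def)

lemma D_add: "D (x + y) = D x + D y"
  using derivation by (auto simp: derivation_def Vector_Spaces.linear_iff)

text \<open>This is q(T) applied to the bracket, where T replaces the arguments
  \<open>(x, y)\<close> by \<open>(P x, D y)\<close>; writing out values avoids constructing a space
  of bilinear maps.\<close>

definition act :: "'k poly \<Rightarrow> 'a \<Rightarrow> 'a \<Rightarrow> 'a" where
  "act q x y = (\<Sum>i\<le>degree q. scale (coeff q i) (bracket ((P ^^ i) x) ((D ^^ i) y)))"

lemma act_0 [simp]: "act 0 x y = 0"
  by (simp add: act_def)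

lemma act_pCons: "act (pCons a q) x y = scale a (bracket x y) + act q (P x) (D y)"
proof (cases "q = 0")
  case False
  then show ?thesis
    unfolding act_def degree_pCons_eq[OF False] sum.atMost_Suc_shift
    by (simp add: funpow_swap1)
qed (simp add: act_def)

lemma act_1 [simp]: "act 1 x y = bracket x y"
  by (simp add: act_pCons one_pCons)

lemma act_add: "act (p + q) x y = act p x y + act q x y"
  by (induction p q arbitrary: x y rule: poly_induct2) (simp_all add: act_pCons scale_left_distrib)

lemma act_smult: "act (smult c q) x y = scale c (act q x y)"
  by (induction q arbitrary: x y) (simp_all add: act_pCons scale_right_distrib)

lemma act_diff: "act (p - q) x y = act p x y - act q x y"
  using act_add[of "p - q" q x y] by simp

text \<open>Together with \<open>act_add\<close>, this makes the annihilator of the bracket an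
  ideal. Vanishing is assumed at all arguments because multiplication by t shifts them.\<close>

lemma act_mult_eq_0:
  assumes "\<And>x y. act r x y = 0"
  shows "act (q * r) x y = 0"
  by (induction q arbitrary: x y) (simp_all add: act_pCons act_add act_smult assms)

lemma act_power_X: "act ([:0, 1:] ^ k) x y = bracket ((P ^^ k) x) ((D ^^ k) y)"
  by (induction k arbitrary: x y) (simp_all add: act_pCons funpow_swap1)

text \<open>By the Leibniz rule
  \<open>D (bracket (P x) y) = bracket x y + bracket (P x) (D y)\<close>, so T + 1 applies
  \<open>P\<close> to the left argument and \<open>D\<close> to the value.\<close>

lemma act_power_X_plus_1: "act ([:1, 1:] ^ k) x y = (D ^^ k) (bracket ((P ^^ k) x) y)"
proof (induction k arbitrary: x y)
  case (Suc k)
  have add: "(D ^^ k) (a + b) = (D ^^ k) a + (D ^^ k) b" for a b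
    by (induction k) (simp_all add: D_add)
  have "act ([:1, 1:] ^ Suc k) x y = act ([:1, 1:] ^ k) x y + act ([:1, 1:] ^ k) (P x) (D y)"
    by (simp add: act_add act_pCons)
  also have "\<dots> = (D ^^ k) (bracket (D (P ((P ^^ k) x))) y + bracket (P ((P ^^ k) x)) (D y))"
    by (simp add: Suc add D_P funpow_swap1[of P, symmetric])
  also have "\<dots> = (D ^^ k) (D (bracket (P ((P ^^ k) x)) y))"
    by (simp only: D_bracket)
  finally show ?case
    by (simp add: funpow_swap1)
qed simp

end

section \<open>Periodic derivations\<close>

locale periodic = invertible_derivation scale bracket D P
  for scale :: "'k::field \<Rightarrow> 'a::ab_group_add \<Rightarrow> 'a" and bracket D P +
  fixes n :: nat
  assumes n_pos: "n > 0" and D_n: "D ^^ n = id"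
begin

lemma P_n: "(P ^^ n) x = x"
proof -
  have "(P ^^ k) ((D ^^ k) x) = x" for k x
    by (induction k arbitrary: x) (simp_all add: funpow_swap1 P_D)
  from this[of n x] show ?thesis by (simp add: D_n)
qed

lemma act_annihilators:
  "act ([:0, 1:] ^ n - 1) x y = 0" "act ([:1, 1:] ^ n - 1) x y = 0"
  by (simp_all add: act_diff act_power_X act_power_X_plus_1 P_n D_n)

lemma bracket_eq_0:
  assumes "n mod 6 \<noteq> 0" "(of_int (rho n) :: 'k) \<noteq> 0"
  shows "bracket x y = 0"
proof -
  obtain u v where uv: "u * ([:0, 1:] ^ n - 1) + v * ([:1, 1:] ^ n - 1) = [:rho n:]"
    using rho_in_ideal[OF n_pos assms(1)] by blast
  \<comment> \<open>Over the base field both summands annihilate the bracket, hence so does the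
    nonzero scalar \<open>rho n\<close>.\<close>
  have "of_int_poly u * ([:0, 1:] ^ n - 1) + of_int_poly v * ([:1, 1:] ^ n - 1) = ([:of_int (rho n):] :: 'k poly)"
    using arg_cong[OF uv, of "of_int_poly :: int poly \<Rightarrow> 'k poly"] by (simp add: hom_distribs)
  then have "act [:of_int (rho n):] x y = 0"
    by (metis act_add act_mult_eq_0 act_annihilators add_0)
  then show ?thesis using assms(2) by (simp add: act_pCons)
qed

lemma Phi3_relation:
  assumes "n mod 6 = 0" "(of_int (rho n) :: 'k) \<noteq> 0"
  shows "bracket (D (D x)) y + bracket (D x) (D y) + bracket x (D (D y)) = 0"
proof -
  let ?h = "of_int_poly :: int poly \<Rightarrow> 'k poly"
  obtain f g u v :: "int poly" where
    f: "[:0, 1:] ^ n - 1 = Phi3 * f" and g: "[:1, 1:] ^ n - 1 = Phi3 * g" and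
    uv: "u * f + v * g = [:rho n:]"
    using rho_in_ideal_quotients[OF n_pos assms(1)] by metis
  have "u * ([:0, 1:] ^ n - 1) + v * ([:1, 1:] ^ n - 1) = Phi3 * (u * f + v * g)"
    by (simp add: f g algebra_simps)
  then have "u * ([:0, 1:] ^ n - 1) + v * ([:1, 1:] ^ n - 1) = smult (rho n) Phi3"
    by (simp add: uv)
  from arg_cong[OF this, of ?h]
  have "?h u * ([:0, 1:] ^ n - 1) + ?h v * ([:1, 1:] ^ n - 1) = smult (of_int (rho n)) (?h Phi3)"
    by (simp add: hom_distribs)
  \<comment> \<open>Starting from \<open>D (D x)\<close> cancels the powers of \<open>P\<close> that
    T introduces.\<close>
  then have "act (smult (of_int (rho n)) (?h Phi3)) (D (D x)) y = 0"
    by (metis act_add act_mult_eq_0 act_annihilators add_0)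
  then have "act (?h Phi3) (D (D x)) y = 0"
    using assms(2) by (simp add: act_smult)
  then show ?thesis
    by (simp add: Phi3_def act_pCons P_D add.assoc)
qed

lemma triple_bracket_eq_0:
  assumes "n mod 6 = 0" "(of_int (rho n) :: 'k) \<noteq> 0"
  shows "bracket z (bracket x y) = 0"
proof -
  define E where "E x = D (D (D x))" for x
  note H = Phi3_relation[OF assms]
  \<comment> \<open>The difference of the relation at \<open>(D x, y)\<close> and at
    \<open>(x, D y)\<close> telescopes, as in
    \<open>(a - b) * (a^2 + a * b + b^2) = a^3 - b^3\<close>.\<close>
  have E_swap: "bracket (E x) y = bracket x (E y)" for x y
    using H[of "D x" y] H[of x "D y"] by (simp add: E_def) (metis add.assoc add.commute add_left_cancel)
  have E_bracket: "E (bracket x y) = - bracket (E x) y" for x y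
  proof -
    \<comment> \<open>Leibniz gives the middle term twice; the relation removes everything but one
      copy.\<close>
    have "D (D (bracket x y)) = bracket (D x) (D y)"
      using H[of x y] by (simp add: D_bracket D_add algebra_simps)
    then have "E (bracket x y) + bracket (E x) y = 0"
      using H[of "D x" y] by (simp add: E_def D_bracket algebra_simps)
    then show ?thesis by (simp add: eq_neg_iff_add_eq_0)
  qed
  \<comment> \<open>In a triple bracket, \<open>E\<close> moves from an inner entry to the outer one
    at the cost of a sign.\<close>
  have triple1: "bracket a (bracket (E b) c) = - bracket (E a) (bracket b c)" for a b c
    using E_swap[of a "bracket b c"] by (simp add: E_bracket bracket_minus_right)
  then have triple2: "bracket a (bracket b (E c)) = - bracket (E a) (bracket b c)" for a b c
    by (simp add: E_swap)
  have *: "bracket (E z) (bracket x y) = 0" for x y z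
  proof -
    let ?p = "bracket (E x) (bracket y z)" and ?q = "bracket (E y) (bracket z x)"
      and ?r = "bracket (E z) (bracket x y)"
    \<comment> \<open>Jacobi with \<open>E\<close> on the first entry, then on the second; in the
      sum \<open>?p\<close> and \<open>?q\<close> cancel.\<close>
    have "?p - ?q - ?r = 0"
      using jacobi[of "E x" y z] by (simp add: triple1 triple2)
    moreover have "- ?p + ?q - ?r = 0"
      using jacobi[of x "E y" z] by (simp add: triple1 triple2)
    moreover have "- (?r + ?r) = (?p - ?q - ?r) + (- ?p + ?q - ?r)" by (simp add: algebra_simps)
    ultimately have "?r + ?r = 0" by (metis add_0 neg_equal_0_iff_equal)
    then have "scale 2 ?r = 0"
      by (metis one_add_one scale_left_distrib scale_one)
    moreover have "(2 :: 'k) \<noteq> 0"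
      using CHAR_2_imp_rho_eq_0[OF n_pos assms(1)] assms(2) by blast
    ultimately show ?thesis by simp
  qed
  \<comment> \<open>\<open>E\<close> is surjective, so the outer entry is arbitrary.\<close>
  have "E (P (P (P z))) = z" by (simp add: E_def D_P)
  then show ?thesis using *[of "P (P (P z))" x y] by simp
qed

end

section \<open>Lower central series and the bound on the class\<close>

context lie_algebra
begin

lemma nilpotent_class_le:
  assumes "lower_central c = {0}"
  shows "nilpotent \<and> nilpotency_class \<le> c"
  using assms by (auto simp: nilpotent_def nilpotency_class_def intro: Least_le)

lemma lower_central_Suc_eq_0:
  assumes "\<And>x y. y \<in> lower_central c \<Longrightarrow> bracket x y = 0"
  shows "lower_central (Suc c) = {0}"
proof -
  have "{bracket x y |x y. y \<in> lower_central c} \<subseteq> {0}" using assms by auto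
  then have "lower_central (Suc c) \<subseteq> span {0}"
    unfolding lower_central.simps by (rule span_mono)
  moreover have "0 \<in> lower_central (Suc c)" by (simp add: span_zero)
  ultimately show ?thesis by auto
qed

lemma bracket_span_eq_0:
  assumes "\<And>y. y \<in> S \<Longrightarrow> bracket x y = 0" "y \<in> span S"
  shows "bracket x y = 0"
  using module_hom.eq_0_on_span[OF linear_right[unfolded linear_iff_module_hom]] assms by blast

end

theorem theorem3p6:
  fixes scale :: "'k::field \<Rightarrow> 'a::ab_group_add \<Rightarrow> 'a"
    and bracket :: "'a \<Rightarrow> 'a \<Rightarrow> 'a"
    and Basis :: "'a set"
    and D :: "'a \<Rightarrow> 'a"
    and n :: nat
  assumes "lie_algebra scale bracket"
    and "finite_dimensional_vector_space scale Basis"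
    and "lie_algebra.periodic_derivation scale bracket D n"
    and "\<not> int CHAR('k) dvd rho n"
  shows "lie_algebra.nilpotent scale bracket \<and>
    lie_algebra.nilpotency_class scale bracket \<le> (if n mod 6 \<noteq> 0 then 1 else 2)"
proof -
  interpret lie_algebra scale bracket by fact
  have D: "derivation D" "n > 0" "D ^^ n = id"
    using assms(3) by (auto simp: periodic_derivation_def)
  have "D ((D ^^ (n - 1)) x) = x" "(D ^^ (n - 1)) (D x) = x" for x
    using D by (metis Suc_diff_1 comp_apply funpow.simps(2) id_apply,
        metis Suc_diff_1 comp_apply funpow_Suc_right id_apply)
  then interpret periodic scale bracket D "D ^^ (n - 1)" n
    using D by unfold_locales auto
  \<comment> \<open>This covers characteristic 0 as well, since 0 divides only 0.\<close>
  have rho: "(of_int (rho n) :: 'k) \<noteq> 0"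
    using assms(4) by (simp add: of_int_eq_0_iff_char_dvd)
  show ?thesis
  proof (cases "n mod 6 = 0")
    case False
    have "lower_central (Suc 0) = {0}"
      by (rule lower_central_Suc_eq_0) (rule bracket_eq_0[OF False rho])
    from nilpotent_class_le[OF this] show ?thesis using False by simp
  next
    case True
    have "lower_central (Suc (Suc 0)) = {0}"
    proof (rule lower_central_Suc_eq_0)
      fix x y
      assume "y \<in> lower_central (Suc 0)"
      \<comment> \<open>Here \<open>y\<close> is a linear combination of brackets, so vanishing on
        triple brackets extends by linearity.\<close>
      then show "bracket x y = 0"
        unfolding lower_central.simps
        by (rule bracket_span_eq_0[rotated]) (auto simp: triple_bracket_eq_0[OF True rho])
    qed
    from nilpotent_class_le[OF this] show ?thesis using True by simp
  qed
qed

end
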